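(* Let $S$ be a nilpotent-free semiring and let $B$ be an amount $S$-semialgebra with amount function $A$. Then $B$ is Armendariz, i.e. for all $f,g\in B$, $fg=0$ implies $A_fA_g=(0)$.
   Context: A semiring is a set $S$ with operations $+,\cdot$ such that $(S,+,0)$ and $(S,\cdot,1)$ are commutative monoids with $1\neq 0$, multiplication distributes over addition, and $s\cdot 0=0$ for all $s$. An ideal of $S$ is a nonempty subset closed under addition and under multiplication by elements of $S$; $\mathrm{Id}(S)$ is the set of ideals of $S$. $IJ$ denotes the ideal of all finite sums of products $xy$ with $x\in I$, $y\in J$; $I^0=S$. $S$ is nilpotent-free if $s^2=0$ implies $s=0$ for all $s\in S$. An $S$-semialgebra is a semiring $B$ together with a semiring morphism $\gamma: S\to B$ (preserving $+,\cdot,0,1$); write $sf=\gamma(s)f$. An amount function is a function $A: B\to \mathrm{Id}(S)$, $f\mapsto A_f$, such that for all $s\in S$, $f,g\in B$: (1) $A_0=(0)$ and $A_1=S$; (2) $A_f=(0)$ implies $f=0$; (3) $A_{sf}=sA_f$; (4) $A_{fg}\subseteq A_fA_g$. $B$ is an amount $S$-semialgebra if: (i) there is an amount function $A: B\to\mathrm{Id}(S)$ such that for all $f,g\in B$ there are non-negative integers $m,n$ with $A_f^mA_g^nA_{fg}=A_f^{m+1}A_g^{n+1}$; and (ii) there is a function $\epsilon:\mathrm{Id}(S)\to\mathrm{Id}(B)$, $I\mapsto I^{\epsilon}$, such that $A_f\subseteq I$ if and only if $f\in I^\epsilon$ (for all $f\in B$, $I\in \mathrm{Id}(S)$), and $I^{\epsilon}\cap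 S=I$ for all $I$ (where $I^\epsilon\cap S$ means $\gamma^{-1}(I^\epsilon)$). *)

theory Defs
  imports Main
begin

text \<open>Semirings in the sense used here (commutative, with \<open>1 \<noteq> 0\<close> and \<open>s * 0 = 0\<close>) are exactly
  the types of class \<^class>\<open>comm_semiring_1\<close>.\<close>

definition nilpotent_free :: "'s::comm_semiring_1 itself \<Rightarrow> bool" where
  "nilpotent_free _ \<longleftrightarrow> (\<forall>s::'s. s ^ 2 = 0 \<longrightarrow> s = 0)"

definition is_ideal :: "'s::comm_semiring_1 set \<Rightarrow> bool" where
  "is_ideal I \<longleftrightarrow> I \<noteq> {} \<and> (\<forall>x\<in>I. \<forall>y\<in>I. x + y \<in> I) \<and> (\<forall>s. \<forall>x\<in>I. s * x \<in> I)"

definition Id_set :: "'s::comm_semiring_1 set set" where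
  "Id_set = {I. is_ideal I}"

definition ideal_prod :: "'s::comm_semiring_1 set \<Rightarrow> 's set \<Rightarrow> 's set" (infixl "\<odot>" 70) where
  "I \<odot> J = {(\<Sum>i<n. x i * y i) | (n::nat) x y. \<forall>i<n. x i \<in> I \<and> y i \<in> J}"

primrec ideal_pow :: "'s::comm_semiring_1 set \<Rightarrow> nat \<Rightarrow> 's set" where
  "ideal_pow I 0 = UNIV"
| "ideal_pow I (Suc n) = ideal_pow I n \<odot> I"

definition semiring_morphism :: "('s::comm_semiring_1 \<Rightarrow> 'b::comm_semiring_1) \<Rightarrow> bool" where
  "semiring_morphism \<gamma> \<longleftrightarrow>
     \<gamma> 0 = 0 \<and> \<gamma> 1 = 1 \<and>
     (\<forall>s t. \<gamma> (s + t) = \<gamma> s + \<gamma> t) \<and> (\<forall>s t. \<gamma> (s * t) = \<gamma> s * \<gamma> t)"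

text \<open>An \<open>S\<close>-semialgebra is given by its structure morphism \<open>\<gamma>\<close>; the scalar multiple \<open>s f\<close>
  is \<open>\<gamma> s * f\<close>.\<close>

definition amount_function ::
  "('s::comm_semiring_1 \<Rightarrow> 'b::comm_semiring_1) \<Rightarrow> ('b \<Rightarrow> 's set) \<Rightarrow> bool" where
  "amount_function \<gamma> A \<longleftrightarrow>
     (\<forall>f. A f \<in> Id_set) \<and>
     A 0 = {0} \<and> A 1 = UNIV \<and>
     (\<forall>f. A f = {0} \<longrightarrow> f = 0) \<and>
     (\<forall>s f. A (\<gamma> s * f) = (\<lambda>x. s * x) ` A f) \<and>
     (\<forall>f g. A (f * g) \<subseteq> A f \<odot> A g)"

definition amount_semialgebra ::
  "('s::comm_semiring_1 \<Rightarrow> 'b::comm_semiring_1) \<Rightarrow> ('b \<Rightarrow> 's set) \<Rightarrow> bool" where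
  "amount_semialgebra \<gamma> A \<longleftrightarrow>
     semiring_morphism \<gamma> \<and>
     amount_function \<gamma> A \<and>
     (\<forall>f g. \<exists>m n. ideal_pow (A f) m \<odot> ideal_pow (A g) n \<odot> A (f * g) =
                   ideal_pow (A f) (m + 1) \<odot> ideal_pow (A g) (n + 1)) \<and>
     (\<exists>\<epsilon>. (\<forall>I\<in>Id_set. \<epsilon> I \<in> Id_set) \<and>
          (\<forall>f. \<forall>I\<in>Id_set. A f \<subseteq> I \<longleftrightarrow> f \<in> \<epsilon> I) \<and>
          (\<forall>I\<in>Id_set. \<gamma> -` \<epsilon> I = I))"

definition armendariz :: "('b::comm_semiring_1 \<Rightarrow> 's::comm_semiring_1 set) \<Rightarrow> bool" where
  "armendariz A \<longleftrightarrow> (\<forall>f g. f * g = 0 \<longrightarrow> A f \<odot> A g = {0})"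

end

theory Submission
  imports Defs
begin

text \<open>If \<open>fg = 0\<close>, the amount formula becomes \<open>A\<^sub>f\<^bsup>m+1\<^esup> A\<^sub>g\<^bsup>n+1\<^esup> = (0)\<close>. Hence for
  \<open>x \<in> A\<^sub>f\<close> and \<open>y \<in> A\<^sub>g\<close> we get \<open>x\<^bsup>m+1\<^esup> y\<^bsup>n+1\<^esup> = 0\<close>, so \<open>xy\<close> is nilpotent and therefore zero.\<close>

text \<open>Squaring lets the exponent descend by one: for \<open>k \<ge> 1\<close> the square of
  \<open>s ^ k\<close> is a multiple of \<open>s ^ Suc k\<close>, so it vanishes and
  nilpotent-freeness gives \<open>s ^ k = 0\<close>.\<close>

lemma nilpotent_free_power_eq_0:
  fixes s :: "'s::comm_semiring_1"
  assumes "nilpotent_free TYPE('s)" and "s ^ k = 0"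
  shows "s = 0"
  using assms(2)
proof (induction k)
  case 0
  then show ?case by simp
next
  case (Suc k)
  show ?case
  proof (cases k)
    case 0
    with Suc.prems show ?thesis by simp
  next
    case (Suc j)
    \<comment> \<open>Since \<open>k = Suc j\<close>, the exponents match:
      \<open>2 * k = Suc k + j\<close>. This splitting needs \<open>k \<ge> 1\<close>.\<close>
    then have "(s ^ k)\<^sup>2 = s ^ Suc k * s ^ j"
      by (simp add: power2_eq_square algebra_simps)
    then have "s ^ k = 0"
      using Suc.prems assms(1) by (simp add: nilpotent_free_def)
    then show ?thesis by (rule Suc.IH)
  qed
qed

lemma mult_in_ideal_prod:
  assumes "x \<in> I" and "y \<in> J"
  shows "x * y \<in> I \<odot> J"
proof -
  have "x * y = (\<Sum>i<(1::nat). x * y)" by simp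
  with assms show ?thesis
    unfolding ideal_prod_def mem_Collect_eq
    by (intro exI[of _ 1] exI[of _ "\<lambda>_. x"] exI[of _ "\<lambda>_. y"]) auto
qed

lemma power_in_ideal_pow: "x \<in> I \<Longrightarrow> x ^ n \<in> ideal_pow I n"
  by (induction n) (simp_all add: mult_in_ideal_prod power_Suc2 del: power_Suc)

lemma ideal_prod_eq_zeroI:
  assumes "\<And>x y. x \<in> I \<Longrightarrow> y \<in> J \<Longrightarrow> x * y = 0"
  shows "I \<odot> J = {0}"
proof -
  \<comment> \<open>The empty sum puts 0 in the product, even if \<open>I\<close> or
    \<open>J\<close> is empty.\<close>
  have "0 \<in> I \<odot> J"
    unfolding ideal_prod_def mem_Collect_eq by (intro exI[of _ 0]) simp
  moreover have "I \<odot> J \<subseteq> {0}"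
    unfolding ideal_prod_def by (auto intro!: sum.neutral assms)
  ultimately show ?thesis by blast
qed

theorem proposition4p2:
  fixes \<gamma> :: "'s::comm_semiring_1 \<Rightarrow> 'b::comm_semiring_1"
    and A :: "'b \<Rightarrow> 's set"
  assumes "nilpotent_free TYPE('s)"
    and "amount_semialgebra \<gamma> A"
  shows "armendariz A"
  unfolding armendariz_def
proof (intro allI impI ideal_prod_eq_zeroI)
  fix f g x y
  assume fg: "f * g = 0" and x: "x \<in> A f" and y: "y \<in> A g"
  have "\<forall>f g. \<exists>m n. ideal_pow (A f) m \<odot> ideal_pow (A g) n \<odot> A (f * g) =
      ideal_pow (A f) (m + 1) \<odot> ideal_pow (A g) (n + 1)"
    using assms(2) unfolding amount_semialgebra_def by (elim conjE)
  then obtain m n where "ideal_pow (A f) m \<odot> ideal_pow (A g) n \<odot> A (f * g) =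
      ideal_pow (A f) (m + 1) \<odot> ideal_pow (A g) (n + 1)"
    by blast
  moreover have "A (f * g) = {0}"
    using assms(2) fg by (simp add: amount_semialgebra_def amount_function_def)
  \<comment> \<open>The left side of the amount formula is now a product with \<open>{0}\<close>,
    hence \<open>{0}\<close> itself.\<close>
  ultimately have "ideal_pow (A f) (m + 1) \<odot> ideal_pow (A g) (n + 1) = {0}"
    by (metis ideal_prod_eq_zeroI mult_zero_right singletonD)
  then have zero: "x ^ (m + 1) * y ^ (n + 1) = 0"
    using mult_in_ideal_prod[OF power_in_ideal_pow[OF x] power_in_ideal_pow[OF y]] by blast
  \<comment> \<open>The sum of the two exponents is at least each of them, so the vanishing product
    splits off without comparing \<open>m\<close> and \<open>n\<close>.\<close>
  have "(x * y) ^ (m + 1 + (n + 1)) = (x ^ (m + 1) * y ^ (n + 1)) * (x ^ (n + 1) * y ^ (m + 1))"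
    by (simp only: power_mult_distrib power_add mult_ac)
  then have "(x * y) ^ (m + 1 + (n + 1)) = 0"
    by (simp only: zero mult_zero_left)
  then show "x * y = 0"
    by (rule nilpotent_free_power_eq_0[OF assms(1)])
qed

end
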